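(* A pair $q=(q_1,q_2)$ is an extreme point of the convex set $$\Big\{q=(q_1,q_2):\ q_1\preceq\hat q_2;\ q_1,q_2:[0,1]\to[0,1]\text{ are nondecreasing and left-continuous}\Big\}$$ if and only if it consists of nondecreasing left-continuous functions $q_1,q_2:[0,1]\to[0,1]$ with $q_1=\hat q_2$.
   Context: For nondecreasing $g_1,g_2:[0,1]\to\mathbb R$, $g_2$ majorizes $g_1$, written $g_1\preceq g_2$, if $\int_x^1 g_1(z)\,dz\le\int_x^1 g_2(z)\,dz$ for all $x\in[0,1]$ with equality at $x=0$. For a nondecreasing left-continuous $g:[0,1]\to[0,1]$, $g^{-1}(z):=\inf\{x\in[0,1]:g(x)>z\}$ (with $\inf\emptyset=1$), and the conjugate of $g$ is $\hat g(z):=1-g^{-1}(1-z)$, which is left-continuous. Functions equal almost everywhere are identified (so the value at $0$ is immaterial). *)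

theory Defs
  imports "HOL-Analysis.Analysis"
begin

text \<open>
  Functions on the unit interval up to equality almost everywhere. A class is represented by total
  functions \<open>real \<Rightarrow> real\<close>; their values outside \<open>{0..1}\<close> are irrelevant.
\<close>

quotient_type ae_fun = "real \<Rightarrow> real" / "\<lambda>f g. AE x in lebesgue_on {0..1}. f x = g x"
  morphisms rep_ae_fun ae_class
proof (rule equivpI)
  show "reflp (\<lambda>f g :: real \<Rightarrow> real. AE x in lebesgue_on {0..1}. f x = g x)"
    by (rule reflpI) simp
  show "symp (\<lambda>f g :: real \<Rightarrow> real. AE x in lebesgue_on {0..1}. f x = g x)"
    by (rule sympI) (erule eventually_mono, simp)
  show "transp (\<lambda>f g :: real \<Rightarrow> real. AE x in lebesgue_on {0..1}. f x = g x)"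
    by (rule transpI) (erule (1) eventually_elim2, simp)
qed

instantiation ae_fun :: real_vector
begin

lift_definition zero_ae_fun :: ae_fun is "\<lambda>_. 0" .

lift_definition plus_ae_fun :: "ae_fun \<Rightarrow> ae_fun \<Rightarrow> ae_fun" is "\<lambda>f g x. f x + g x"
  by (erule (1) eventually_elim2) simp

lift_definition minus_ae_fun :: "ae_fun \<Rightarrow> ae_fun \<Rightarrow> ae_fun" is "\<lambda>f g x. f x - g x"
  by (erule (1) eventually_elim2) simp

lift_definition uminus_ae_fun :: "ae_fun \<Rightarrow> ae_fun" is "\<lambda>f x. - f x"
  by (erule eventually_mono) simp

lift_definition scaleR_ae_fun :: "real \<Rightarrow> ae_fun \<Rightarrow> ae_fun" is "\<lambda>c f x. c * f x"
  by (erule eventually_mono) simp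

instance
  by standard (transfer; simp add: algebra_simps)+

end

definition nondecr_left_cont :: "(real \<Rightarrow> real) set" where
  "nondecr_left_cont =
     {g. g \<in> {0..1} \<rightarrow> {0..1} \<and> mono_on {0..1} g \<and> (\<forall>x\<in>{0<..1}. continuous (at_left x) g)}"

definition gen_inverse :: "(real \<Rightarrow> real) \<Rightarrow> real \<Rightarrow> real" where
  "gen_inverse g z =
     (if \<exists>x\<in>{0..1}. g x > z then Inf {x \<in> {0..1}. g x > z} else 1)"

definition conjugate :: "(real \<Rightarrow> real) \<Rightarrow> real \<Rightarrow> real" where
  "conjugate g z = 1 - gen_inverse g (1 - z)"

text \<open>
  This is only meaningful for \<open>f\<close> and \<open>g\<close> that are nondecreasing on \<open>{0..1}\<close> (hence integrable there).
\<close>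

definition majorized_by :: "(real \<Rightarrow> real) \<Rightarrow> (real \<Rightarrow> real) \<Rightarrow> bool"  (infix "\<preceq>" 50) where
  "f \<preceq> g \<longleftrightarrow>
     (\<forall>x\<in>{0..1}. integral {x..1} f \<le> integral {x..1} g) \<and> integral {0..1} f = integral {0..1} g"

definition majorization_pairs :: "(ae_fun \<times> ae_fun) set" where
  "majorization_pairs =
     {(ae_class q\<^sub>1, ae_class q\<^sub>2) | q\<^sub>1 q\<^sub>2.
        q\<^sub>1 \<in> nondecr_left_cont \<and> q\<^sub>2 \<in> nondecr_left_cont \<and> q\<^sub>1 \<preceq> conjugate q\<^sub>2}"

end

theory Submission
  imports Defs
begin

text \<open>
  The tail integral over \<open>{x..1}\<close> of the conjugate of \<open>q\<close> equals
  \<open>cap q x\<close>, the integral of \<open>min (1 - x) q\<close> over \<open>{0..1}\<close>; both have the same increments up to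
  an error dominated by \<open>(y - x) * (g y - g x)\<close> with \<open>g\<close> the conjugate. So a pair is feasible iff the
  tail of \<open>q1\<close> lies below the cap of \<open>q2\<close>, with equality at \<open>0\<close>, and the cap is concave in \<open>q2\<close>.

  If the constraint binds everywhere, a convex decomposition makes it bind for both parts, and strict
  concavity of the minimum forces the parts to coincide. If it is slack somewhere, take a maximal
  interval of slackness and move \<open>q1\<close> and \<open>q2\<close> simultaneously by small multiples, of equal
  total mass, of tent functions of their own values: such a move keeps monotonicity, and the pair
  is the midpoint of the two perturbed pairs.
\<close>

section \<open>Nondecreasing left-continuous functions\<close>

lemma nlc_mono: "\<lbrakk>q \<in> nondecr_left_cont; 0 \<le> x; x \<le> y; y \<le> 1\<rbrakk> \<Longrightarrow> q x \<le> q y"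
  unfolding nondecr_left_cont_def by (auto intro: mono_onD)

lemma nlc_range: "\<lbrakk>q \<in> nondecr_left_cont; 0 \<le> x; x \<le> 1\<rbrakk> \<Longrightarrow> 0 \<le> q x \<and> q x \<le> 1"
  unfolding nondecr_left_cont_def by auto

lemma nlc_mono_on: "q \<in> nondecr_left_cont \<Longrightarrow> mono_on {0..1} q"
  unfolding nondecr_left_cont_def by auto

text \<open>A strict lower bound at a single point spreads to an interval of positive length on its
  left, where integrals can detect it.\<close>

lemma nlc_left:
  assumes "q \<in> nondecr_left_cont" "0 < x" "x \<le> 1" "l < q x"
  obtains y where "0 < y" "y < x" "\<And>z. \<lbrakk>y \<le> z; z \<le> x\<rbrakk> \<Longrightarrow> l < q z"
proof -
  have "(q \<longlongrightarrow> q x) (at_left x)"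
    using assms unfolding nondecr_left_cont_def continuous_within by auto
  then have "\<forall>\<^sub>F z in at_left x. l < q z" using assms(4) by (rule order_tendstoD)
  then obtain w where w: "w < x" "\<And>z. w < z \<Longrightarrow> z < x \<Longrightarrow> l < q z"
    unfolding eventually_at_left_field by blast
  define y where "y = (max w 0 + x) / 2"
  have y: "0 < y" "y < x" "w < y" using w(1) assms(2) by (auto simp: y_def max_def field_simps)
  show thesis
  proof (rule that[OF y(1,2)])
    show "l < q z" if "y \<le> z" "z \<le> x" for z
      using w(2)[of z] y that assms(4) by (cases "z = x") auto
  qed
qed

text \<open>By monotonicity the values to the left of \<open>x\<close> never exceed
  \<open>q x\<close>, and a lower bound at one point \<open>y\<close> persists up to
  \<open>x\<close>. So one witness for each level \<open>l\<close> already yields the left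
  limit.\<close>

lemma nlcI:
  assumes "\<And>x. \<lbrakk>0 \<le> x; x \<le> 1\<rbrakk> \<Longrightarrow> 0 \<le> q x \<and> q x \<le> 1"
    and mono: "\<And>x y. \<lbrakk>0 \<le> x; x \<le> y; y \<le> 1\<rbrakk> \<Longrightarrow> q x \<le> q y"
    and left: "\<And>x l. \<lbrakk>0 < x; x \<le> 1; l < q x\<rbrakk> \<Longrightarrow> \<exists>y. 0 \<le> y \<and> y < x \<and> l < q y"
  shows "q \<in> nondecr_left_cont"
proof -
  have "(q \<longlongrightarrow> q x) (at_left x)" if x: "0 < x" "x \<le> 1" for x
  proof (rule order_tendstoI)
    fix l assume "l < q x"
    then obtain y where y: "0 \<le> y" "y < x" "l < q y" using left x by blast
    then have "l < q z" if "y < z" "z < x" for z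
      using mono[of y z] that x by linarith
    then show "\<forall>\<^sub>F z in at_left x. l < q z"
      using y(2) unfolding eventually_at_left_field by blast
  next
    fix u assume u: "q x < u"
    have "q z < u" if "0 < z" "z < x" for z using mono[of z x] that x u by linarith
    then show "\<forall>\<^sub>F z in at_left x. q z < u"
      using x(1) unfolding eventually_at_left_field by blast
  qed
  then show ?thesis
    using assms(1) mono unfolding nondecr_left_cont_def continuous_within by (auto intro: mono_onI)
qed

section \<open>Integrability, tail integrals and caps\<close>

lemma mono_on_integrable:
  fixes f :: "real \<Rightarrow> real"
  assumes "mono_on {0..1} f" "0 \<le> a" "b \<le> 1"
  shows "f integrable_on {a..b}"
  by (rule integrable_on_mono_on, rule mono_on_subset[OF assms(1)]) (use assms(2,3) in auto)

lemma nlc_integrable: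
  "\<lbrakk>q \<in> nondecr_left_cont; 0 \<le> a; b \<le> 1\<rbrakk> \<Longrightarrow> q integrable_on {a..b}"
  by (rule mono_on_integrable[OF nlc_mono_on])

definition tail :: "(real \<Rightarrow> real) \<Rightarrow> real \<Rightarrow> real" where
  "tail f x = integral {x..1} f"

definition cap :: "(real \<Rightarrow> real) \<Rightarrow> real \<Rightarrow> real" where
  "cap q x = integral {0..1} (\<lambda>y. min (1 - x) (q y))"

lemma cap_integrable:
  assumes q: "q \<in> nondecr_left_cont" and "0 \<le> a" "b \<le> 1"
  shows "(\<lambda>y. min k (q y)) integrable_on {a..b}"
proof (rule mono_on_integrable)
  show "mono_on {0..1} (\<lambda>y. min k (q y))"
  proof (rule mono_onI)
    fix x y :: real assume "x \<in> {0..1}" "y \<in> {0..1}" "x \<le> y"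
    then show "min k (q x) \<le> min k (q y)" using nlc_mono[OF q, of x y] by simp
  qed
qed (use assms in auto)

lemma tail_diff:
  assumes "f integrable_on {0..1}" "0 \<le> x" "x \<le> y" "y \<le> 1"
  shows "tail f x - tail f y = integral {x..y} f"
proof -
  have "f integrable_on {x..1}"
    using assms(1) by (rule integrable_on_subinterval) (use assms in auto)
  from Henstock_Kurzweil_Integration.integral_combine[OF assms(3,4) this]
  show ?thesis by (simp add: tail_def)
qed

text \<open>The endpoints are negligible, so bounds in the open interval suffice. This covers
  integrands that jump at an endpoint or have an arbitrary value at 0.\<close>

lemma integral_bounds:
  fixes f :: "real \<Rightarrow> real"
  assumes "f integrable_on {a..b}" "a \<le> b" "\<And>x. \<lbrakk>a < x; x < b\<rbrakk> \<Longrightarrow> l \<le> f x \<and> f x \<le> u"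
  shows "(b - a) * l \<le> integral {a..b} f" "integral {a..b} f \<le> (b - a) * u"
proof -
  have n: "negligible {a, b}" by (simp add: negligible_finite)
  define g where "g x = (if x \<in> {a,b} then l else f x)" for x
  define h where "h x = (if x \<in> {a,b} then u else f x)" for x
  have g: "integral {a..b} g = integral {a..b} f" "g integrable_on {a..b}"
    by (rule integral_spike[OF n], simp add: g_def, rule integrable_spike[OF assms(1) n], simp add: g_def)
  have h: "integral {a..b} h = integral {a..b} f" "h integrable_on {a..b}"
    by (rule integral_spike[OF n], simp add: h_def, rule integrable_spike[OF assms(1) n], simp add: h_def)
  have "integral {a..b} (\<lambda>_. l) \<le> integral {a..b} g"
    by (rule integral_le) (use g(2) assms(3) in \<open>auto simp: g_def\<close>)
  then show "(b - a) * l \<le> integral {a..b} f" using assms(2) g by simp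
  have "integral {a..b} h \<le> integral {a..b} (\<lambda>_. u)"
    by (rule integral_le) (use h(2) assms(3) in \<open>auto simp: h_def\<close>)
  then show "integral {a..b} f \<le> (b - a) * u" using assms(2) h by simp
qed

lemma tail_diff_bounds:
  assumes "mono_on {0..1} f" "0 \<le> x" "x \<le> y" "y \<le> 1"
  shows "(y - x) * f x \<le> tail f x - tail f y" "tail f x - tail f y \<le> (y - x) * f y"
proof -
  have i: "f integrable_on {x..y}" "f integrable_on {0..1}"
    using assms mono_on_integrable by auto
  have "f x \<le> f z \<and> f z \<le> f y" if "x < z" "z < y" for z
    using that assms(2-4) by (intro conjI mono_onD[OF assms(1)]) auto
  from integral_bounds[OF i(1) assms(3) this]
  show "(y - x) * f x \<le> tail f x - tail f y" "tail f x - tail f y \<le> (y - x) * f y"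
    unfolding tail_diff[OF i(2) assms(2-4)] by auto
qed

text \<open>The value \<open>f x\<close> separates slopes: on average the tail falls at a rate of at
  most \<open>f x\<close> before \<open>x\<close> and at least \<open>f x\<close> after it.
  Weighting these bounds by \<open>b - x\<close> and \<open>x - a\<close> gives the chord
  inequality.\<close>

lemma tail_concave:
  assumes f: "mono_on {0..1} f" and "0 \<le> a" "a \<le> x" "x \<le> b" "b \<le> 1"
  shows "(b - x) * tail f a + (x - a) * tail f b \<le> (b - a) * tail f x"
proof -
  have 1: "tail f a - tail f x \<le> (x - a) * f x" and 2: "(b - x) * f x \<le> tail f x - tail f b"
    using tail_diff_bounds[OF f] assms by auto
  have "(b - x) * (tail f a - tail f x) \<le> (b - x) * ((x - a) * f x)"
    using 1 assms by (intro mult_left_mono) auto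
  moreover have "(x - a) * ((b - x) * f x) \<le> (x - a) * (tail f x - tail f b)"
    using 2 assms by (intro mult_left_mono) auto
  ultimately show ?thesis by (simp add: algebra_simps)
qed

text \<open>Over \<open>N\<close> equal pieces the right-hand sides telescope to
  \<open>K / N\<close>, and \<open>N\<close> is arbitrary. No regularity of \<open>g\<close> enters,
  so jumps are harmless.\<close>

lemma eq_if_increments_dominated:
  fixes D g :: "real \<Rightarrow> real"
  assumes "a \<le> b"
    and bd: "\<And>x y. \<lbrakk>a \<le> x; x \<le> y; y \<le> b\<rbrakk> \<Longrightarrow> \<bar>D x - D y\<bar> \<le> (y - x) * (g y - g x)"
  shows "D a = D b"
proof -
  define K where "K = (b - a) * (g b - g a)"
  have *: "\<bar>D a - D b\<bar> * real N \<le> K" if N: "N > 0" for N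
  proof -
    define p where "p i = a + real i * ((b - a) / real N)" for i
    have p0: "p 0 = a" and pN: "p N = b" using N by (auto simp: p_def)
    have pm: "p i \<le> p j" if "i \<le> j" for i j
      unfolding p_def using that assms(1) by (intro add_left_mono mult_right_mono) auto
    have step: "\<bar>D (p i) - D (p (Suc i))\<bar> \<le> (b - a) / N * (g (p (Suc i)) - g (p i))" if "i < N" for i
    proof -
      have "p (Suc i) - p i = (b - a) / N" by (simp add: p_def distrib_right add_divide_distrib)
      moreover have "a \<le> p i" "p i \<le> p (Suc i)" "p (Suc i) \<le> b"
        using pm[of 0 i] pm[of i "Suc i"] pm[of "Suc i" N] that p0 pN by auto
      ultimately show ?thesis using bd[of "p i" "p (Suc i)"] by metis
    qed
    have "\<bar>D (p 0) - D (p n)\<bar> \<le> (b - a) / N * (g (p n) - g (p 0))" if "n \<le> N" for n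
      using that
    proof (induction n)
      case (Suc n)
      have "\<bar>D (p 0) - D (p (Suc n))\<bar> \<le> \<bar>D (p 0) - D (p n)\<bar> + \<bar>D (p n) - D (p (Suc n))\<bar>" by linarith
      also have "\<dots> \<le> (b - a) / N * (g (p n) - g (p 0)) + (b - a) / N * (g (p (Suc n)) - g (p n))"
        using Suc step[of n] by (intro add_mono) auto
      finally show ?case by (simp add: algebra_simps)
    qed simp
    from this[of N] p0 pN have "\<bar>D a - D b\<bar> \<le> K / N" by (simp add: K_def)
    then show ?thesis using N by (simp add: field_simps)
  qed
  have "\<bar>D a - D b\<bar> = 0"
  proof (rule ccontr)
    assume "\<bar>D a - D b\<bar> \<noteq> 0"
    then have pos: "\<bar>D a - D b\<bar> > 0" by simp
    obtain N where N: "max K 0 < real N * \<bar>D a - D b\<bar>"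
      using reals_Archimedean3[OF pos] by blast
    then have "N > 0" by (cases N) auto
    with *[of N] N show False by (simp add: mult.commute)
  qed
  then show ?thesis by simp
qed

section \<open>The generalized inverse and the tail of the conjugate\<close>

lemma gen_inverse_bounds: "0 \<le> gen_inverse q k" "gen_inverse q k \<le> 1"
proof -
  have "0 \<le> Inf {x \<in> {0..1}. q x > k} \<and> Inf {x \<in> {0..1}. q x > k} \<le> 1" if ex: "\<exists>x\<in>{0..1}. q x > k"
  proof -
    obtain x where x: "x \<in> {x \<in> {0..1}. q x > k}" using ex by blast
    have "Inf {x \<in> {0..1}. q x > k} \<le> x" by (rule cInf_lower[OF x]) (auto intro: bdd_belowI[of _ 0])
    moreover have "0 \<le> Inf {x \<in> {0..1}. q x > k}" by (rule cInf_greatest) (use x in auto)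
    ultimately show ?thesis using x by auto
  qed
  then show "0 \<le> gen_inverse q k" "gen_inverse q k \<le> 1" by (auto simp: gen_inverse_def)
qed

lemma gen_inverse_le: "\<lbrakk>0 \<le> x; x \<le> 1; k < q x\<rbrakk> \<Longrightarrow> gen_inverse q k \<le> x"
  unfolding gen_inverse_def by (auto intro!: cInf_lower bdd_belowI[of _ 0])

lemma gen_inverse_less_ex:
  assumes "gen_inverse q k < u" "u \<le> 1"
  obtains x where "0 \<le> x" "x < u" "k < q x"
proof -
  have ex: "\<exists>x\<in>{0..1}. q x > k" using assms by (auto simp: gen_inverse_def split: if_splits)
  then have "Inf {x \<in> {0..1}. q x > k} < u" using assms by (simp add: gen_inverse_def)
  then obtain x where "x \<in> {x \<in> {0..1}. q x > k}" "x < u"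
    using ex by (metis (no_types, lifting) cInf_lessD empty_iff mem_Collect_eq)
  then show thesis by (auto intro: that)
qed

lemma gen_inverse_mono: "j \<le> k \<Longrightarrow> gen_inverse q j \<le> gen_inverse q k"
proof (rule ccontr)
  assume "j \<le> k" "\<not> gen_inverse q j \<le> gen_inverse q k"
  then obtain x where "0 \<le> x" "x < gen_inverse q j" "k < q x"
    using gen_inverse_less_ex[of q k "gen_inverse q j"] gen_inverse_bounds(2)[of q j] by auto
  then show False using gen_inverse_le[of x j q] \<open>j \<le> k\<close> gen_inverse_bounds(2)[of q j] by auto
qed

lemma conjugate_nlc: "conjugate q \<in> nondecr_left_cont"
proof (rule nlcI)
  show "0 \<le> conjugate q x \<and> conjugate q x \<le> 1" for x
    using gen_inverse_bounds[of q "1 - x"] by (simp add: conjugate_def)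
  show "conjugate q x \<le> conjugate q y" if "x \<le> y" for x y
    using gen_inverse_mono[of "1 - y" "1 - x" q] that by (simp add: conjugate_def)
  fix x l :: real assume x: "0 < x" "x \<le> 1" "l < conjugate q x"
  show "\<exists>y. 0 \<le> y \<and> y < x \<and> l < conjugate q y"
  \<comment> \<open>The witness below comes from \<open>gen_inverse_less_ex\<close> with the bound
    \<open>1 - l\<close>, which must not exceed 1. Negative levels are settled by nonnegativity of
    the conjugate.\<close>
  proof (cases "l < 0")
    case True
    then show ?thesis using x gen_inverse_bounds[of q "1 - 0"] by (intro exI[of _ 0]) (simp add: conjugate_def)
  next
    case False
    then obtain u where u: "0 \<le> u" "u < 1 - l" "1 - x < q u"
      using gen_inverse_less_ex[of q "1 - x" "1 - l"] x by (auto simp: conjugate_def)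
    \<comment> \<open>The strict inequality \<open>1 - x < q u\<close> leaves room to move left of
      \<open>x\<close>: the midpoint of \<open>1 - q u\<close> and \<open>x\<close>, cut off at 0,
      keeps \<open>1 - y\<close> below \<open>q u\<close>.\<close>
    define y where "y = max 0 ((x + (1 - q u)) / 2)"
    have "0 \<le> y" "y < x" using u x by (auto simp: y_def max_def field_simps)
    moreover have "1 - y < q u"
      using u x by (auto simp: y_def max_def field_simps)
    ultimately have "gen_inverse q (1 - y) \<le> u" "0 \<le> y" "y < x"
      using gen_inverse_le[of u "1 - y" q] u False by auto
    then show ?thesis using u by (intro exI[of _ y]) (simp add: conjugate_def)
  qed
qed

text \<open>Lowering the truncation level from \<open>1 - x\<close> to \<open>1 - y\<close> costs
  the full \<open>y - x\<close> where \<open>q\<close> exceeds \<open>1 - x\<close>, a set of length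
  \<open>conjugate q x\<close>. It costs nothing outside the set where \<open>q\<close> exceeds
  \<open>1 - y\<close>, which has length \<open>conjugate q y\<close>.\<close>

lemma cap_diff_bounds:
  assumes q: "q \<in> nondecr_left_cont" and xy: "0 \<le> x" "x \<le> y" "y \<le> 1"
  shows "(y - x) * conjugate q x \<le> cap q x - cap q y" "cap q x - cap q y \<le> (y - x) * conjugate q y"
proof -
  define f where "f w = min (1 - x) (q w) - min (1 - y) (q w)" for w
  have fi: "f integrable_on {a..b}" if "0 \<le> a" "b \<le> 1" for a b
    unfolding f_def using that by (intro integrable_diff cap_integrable q)
  have f01: "0 \<le> f w \<and> f w \<le> y - x" for w using xy by (auto simp: f_def)
  have eq: "cap q x - cap q y = integral {0..1} f"
    unfolding cap_def f_def by (rule integral_diff[symmetric]) (auto intro!: cap_integrable q)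
  have split: "integral {0..1} f = integral {0..g} f + integral {g..1} f" if "0 \<le> g" "g \<le> 1" for g
    using Henstock_Kurzweil_Integration.integral_combine[OF that fi] by simp
  let ?g = "gen_inverse q (1 - x)" and ?h = "gen_inverse q (1 - y)"
  note gb = gen_inverse_bounds[of q "1 - x"] and hb = gen_inverse_bounds[of q "1 - y"]
  have "y - x \<le> f w" if w: "?g < w" "w < 1" for w
  proof -
    obtain z where "0 \<le> z" "z < w" "1 - x < q z"
      using gen_inverse_less_ex[of q "1 - x" w] w by auto
    then have "1 - x < q w" using nlc_mono[OF q, of z w] w by auto
    then show ?thesis using xy by (auto simp: f_def)
  qed
  then have "(1 - ?g) * (y - x) \<le> integral {?g..1} f"
    using gb f01 by (intro integral_bounds(1)[where u = "y - x"] fi) auto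
  moreover have "(?g - 0) * 0 \<le> integral {0..?g} f"
    using gb f01 by (intro integral_bounds(1)[where u = "y - x"] fi) auto
  ultimately show "(y - x) * conjugate q x \<le> cap q x - cap q y"
    using split[OF gb] eq by (simp add: conjugate_def algebra_simps)
  have "f w \<le> 0" if w: "0 < w" "w < ?h" for w
  proof -
    have "q w \<le> 1 - y" using gen_inverse_le[of w "1 - y" q] w hb by fastforce
    then show ?thesis using xy by (auto simp: f_def)
  qed
  then have "integral {0..?h} f \<le> (?h - 0) * 0"
    using hb f01 by (intro integral_bounds(2)[where l = 0] fi) auto
  moreover have "integral {?h..1} f \<le> (1 - ?h) * (y - x)"
    using hb f01 by (intro integral_bounds(2)[where l = 0] fi) auto
  ultimately show "cap q x - cap q y \<le> (y - x) * conjugate q y"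
    using split[OF hb] eq by (simp add: conjugate_def algebra_simps)
qed

lemma tail_conjugate:
  assumes q: "q \<in> nondecr_left_cont" and x: "0 \<le> x" "x \<le> 1"
  shows "tail (conjugate q) x = cap q x"
proof -
  have "tail (conjugate q) x - cap q x = tail (conjugate q) 1 - cap q 1"
  proof (rule eq_if_increments_dominated[OF x(2)])
    fix y z :: real assume yz: "x \<le> y" "y \<le> z" "z \<le> 1"
    then show "\<bar>tail (conjugate q) y - cap q y - (tail (conjugate q) z - cap q z)\<bar>
        \<le> (z - y) * (conjugate q z - conjugate q y)"
      using cap_diff_bounds[OF q, of y z] tail_diff_bounds[OF nlc_mono_on[OF conjugate_nlc[of q]], of y z] x
      by (simp add: right_diff_distrib abs_le_iff)
  qed
  moreover have "cap q 1 = integral {0..1} (\<lambda>_ :: real. 0 :: real)"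
    unfolding cap_def by (rule Henstock_Kurzweil_Integration.integral_cong) (use nlc_range[OF q] in auto)
  ultimately show ?thesis by (simp add: tail_def)
qed

lemma majorized_by_conjugate_iff:
  assumes "q \<in> nondecr_left_cont"
  shows "p \<preceq> conjugate q \<longleftrightarrow> (\<forall>x\<in>{0..1}. tail p x \<le> cap q x) \<and> tail p 0 = cap q 0"
  using tail_conjugate[OF assms] unfolding majorized_by_def by (auto simp: tail_def)

section \<open>Recovering functions from tails and from classes\<close>

lemma nlc_le_if_tail_eq:
  assumes q: "q \<in> nondecr_left_cont" and r: "r \<in> nondecr_left_cont"
    and eq: "\<And>x. \<lbrakk>0 \<le> x; x \<le> 1\<rbrakk> \<Longrightarrow> tail q x = tail r x" and x: "0 < x" "x \<le> 1"
  shows "r x \<le> q x"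
proof (rule ccontr)
  assume "\<not> r x \<le> q x"
  then obtain y where y: "0 < y" "y < x" and "q x < r y"
    using nlc_left[OF r x, of "q x"] by (metis order_refl less_imp_le not_le)
  \<comment> \<open>Both functions have the same integral over \<open>{y..x}\<close>; it is at least
    \<open>(x - y) * r y\<close> and at most \<open>(x - y) * q x\<close>.\<close>
  moreover have "(x - y) * r y \<le> (x - y) * q x"
    using tail_diff_bounds(1)[OF nlc_mono_on[OF r], of y x]
      tail_diff_bounds(2)[OF nlc_mono_on[OF q], of y x] eq[of x] eq[of y] x y by linarith
  ultimately show False by simp
qed

lemma nlc_eq_if_tail_eq:
  assumes "q \<in> nondecr_left_cont" "r \<in> nondecr_left_cont"
    and "\<And>x. \<lbrakk>0 \<le> x; x \<le> 1\<rbrakk> \<Longrightarrow> tail q x = tail r x" and "0 < x" "x \<le> 1"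
  shows "q x = r x"
  using nlc_le_if_tail_eq[of q r x] nlc_le_if_tail_eq[of r q x] assms by force

lemma ae_class_eqI:
  assumes "\<And>x. \<lbrakk>0 < x; x \<le> 1\<rbrakk> \<Longrightarrow> f x = g x"
  shows "ae_class f = ae_class g"
proof -
  have "{0} \<in> null_sets (lebesgue_on {0..1::real})"
    by (auto simp: null_sets_restrict_space)
  then have "AE x in lebesgue_on {0..1}. f x = g x"
    by (rule AE_I') (use assms in \<open>force simp: not_less\<close>)
  then show ?thesis by (simp add: ae_fun.abs_eq_iff)
qed

lemma tail_eq_if_ae_class_eq:
  assumes "ae_class f = ae_class g" "0 \<le> x"
  shows "tail f x = tail g x"
proof -
  have "AE x in lebesgue_on {0..1}. f x = g x"
    using assms(1) by (simp add: ae_fun.abs_eq_iff)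
  then obtain N where "N \<in> null_sets (lebesgue_on {0..1})" "{x \<in> {0..1}. f x \<noteq> g x} \<subseteq> N"
    by (auto simp: eventually_ae_filter)
  then have N: "negligible N" and sub: "{x \<in> {0..1}. f x \<noteq> g x} \<subseteq> N"
    by (auto simp: negligible_iff_null_sets null_sets_restrict_space)
  have "g z = f z" if "z \<in> {x..1} - N" for z
  proof (rule ccontr)
    assume "g z \<noteq> f z"
    then have "z \<in> {x \<in> {0..1}. f x \<noteq> g x}" using that assms(2) by auto
    then show False using sub that by blast
  qed
  then show ?thesis unfolding tail_def by (rule integral_spike[OF N]) 
qed

lemma nlc_eq_if_ae_class_eq:
  assumes "q \<in> nondecr_left_cont" "r \<in> nondecr_left_cont" "ae_class q = ae_class r" "0 < x" "x \<le> 1"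
  shows "q x = r x"
proof (rule nlc_eq_if_tail_eq[OF assms(1,2) _ assms(4,5)])
  show "tail q z = tail r z" if "0 \<le> z" for z using tail_eq_if_ae_class_eq[OF assms(3) that] .
qed

section \<open>Convex combinations and concavity of the cap\<close>

lemma ae_class_convex_comb:
  "a *\<^sub>R ae_class f + b *\<^sub>R ae_class g = ae_class (\<lambda>x. a * f x + b * g x)"
  by (simp add: plus_ae_fun.abs_eq scaleR_ae_fun.abs_eq)

lemma nlc_convex_comb:
  assumes q: "q \<in> nondecr_left_cont" and r: "r \<in> nondecr_left_cont" and t: "0 \<le> t" "t \<le> 1"
  shows "(\<lambda>x. (1 - t) * q x + t * r x) \<in> nondecr_left_cont"
proof -
  have "0 \<le> (1 - t) * q x + t * r x \<and> (1 - t) * q x + t * r x \<le> 1" if "0 \<le> x" "x \<le> 1" for x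
    using nlc_range[OF q that] nlc_range[OF r that] t
      convex_bound_le[of "q x" 1 "r x" "1 - t" t] by simp
  moreover have "(1 - t) * q x + t * r x \<le> (1 - t) * q y + t * r y" if "0 \<le> x" "x \<le> y" "y \<le> 1" for x y
    using nlc_mono[OF q that] nlc_mono[OF r that] t by (intro add_mono mult_left_mono) auto
  moreover have "continuous (at_left x) (\<lambda>x. (1 - t) * q x + t * r x)" if "x \<in> {0<..1}" for x
    using q r that unfolding nondecr_left_cont_def by (intro continuous_intros) auto
  ultimately show ?thesis unfolding nondecr_left_cont_def by (auto intro!: mono_onI)
qed

lemma integral_pos_if_pos_on_interval:
  fixes f :: "real \<Rightarrow> real"
  assumes f: "f integrable_on {0..1}" "\<And>x. \<lbrakk>0 \<le> x; x \<le> 1\<rbrakk> \<Longrightarrow> 0 \<le> f x"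
    and cd: "0 \<le> c" "c < d" "d \<le> 1" and e: "\<And>x. \<lbrakk>c \<le> x; x \<le> d\<rbrakk> \<Longrightarrow> e \<le> f x" "0 < e"
  shows "0 < integral {0..1} f"
proof -
  have i: "f integrable_on {c..d}"
    using f(1) by (rule integrable_on_subinterval) (use cd in auto)
  have "integral {c..d} (\<lambda>_. e) \<le> integral {c..d} f"
    by (rule integral_le) (use i e in auto)
  also have "\<dots> \<le> integral {0..1} f"
    by (rule integral_subset_le) (use i f cd in auto)
  finally have "(d - c) * e \<le> integral {0..1} f" using cd by simp
  moreover have "0 < (d - c) * e" using cd e(2) by simp
  ultimately show ?thesis by linarith
qed

lemma integral_lincomb:
  fixes f g :: "real \<Rightarrow> real"
  assumes f: "f integrable_on S" and g: "g integrable_on S"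
  shows "(\<lambda>x. c * f x + d * g x) integrable_on S"
    "integral S (\<lambda>x. c * f x + d * g x) = c * integral S f + d * integral S g"
proof -
  have "((\<lambda>x. c * f x + d * g x) has_integral c * integral S f + d * integral S g) S"
    using f g by (intro has_integral_add has_integral_mult_right integrable_integral)
  then show "(\<lambda>x. c * f x + d * g x) integrable_on S"
    "integral S (\<lambda>x. c * f x + d * g x) = c * integral S f + d * integral S g"
    by (auto simp: has_integral_iff)
qed

lemma min_concave:
  fixes a b k t :: real
  assumes "0 \<le> t" "t \<le> 1"
  shows "(1 - t) * min k a + t * min k b \<le> min k ((1 - t) * a + t * b)"
proof -
  have "(1 - t) * min k a + t * min k b \<le> (1 - t) * k + t * k"
    using assms by (intro add_mono mult_left_mono) auto
  moreover have "(1 - t) * min k a + t * min k b \<le> (1 - t) * a + t * b"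
    using assms by (intro add_mono mult_left_mono) auto
  ultimately show ?thesis by (simp add: algebra_simps)
qed

lemma cap_convex_comb_le:
  assumes a: "a \<in> nondecr_left_cont" and b: "b \<in> nondecr_left_cont" and t: "0 \<le> t" "t \<le> 1"
  shows "(1 - t) * cap a x + t * cap b x \<le> cap (\<lambda>y. (1 - t) * a y + t * b y) x"
proof -
  have "(1 - t) * cap a x + t * cap b x
      = integral {0..1} (\<lambda>y. (1 - t) * min (1 - x) (a y) + t * min (1 - x) (b y))"
    unfolding cap_def using cap_integrable[OF a, of 0 1] cap_integrable[OF b, of 0 1]
    by (intro integral_lincomb(2)[symmetric]) auto
  also have "\<dots> \<le> cap (\<lambda>y. (1 - t) * a y + t * b y) x"
    unfolding cap_def using min_concave[OF t] cap_integrable[OF a, of 0 1] cap_integrable[OF b, of 0 1]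
    by (intro integral_le integral_lincomb(1) cap_integrable nlc_convex_comb a b t) auto
  finally show ?thesis .
qed

text \<open>Truncation at a level \<open>k\<close> strictly between \<open>a y\<close> and
  \<open>b y\<close> has its kink between the two values, so concavity is strict there. Left
  continuity of \<open>b\<close> and monotonicity of \<open>a\<close> carry a uniform gain to an
  interval left of \<open>y\<close>. The level \<open>k\<close> is the truncation level at
  \<open>x = 1 - k\<close>.\<close>

lemma cap_convex_comb_less:
  assumes a: "a \<in> nondecr_left_cont" and b: "b \<in> nondecr_left_cont" and t: "0 < t" "t < 1"
    and y: "0 < y" "y \<le> 1" "a y < b y"
  obtains x where "0 \<le> x" "x \<le> 1"
    "(1 - t) * cap a x + t * cap b x < cap (\<lambda>y. (1 - t) * a y + t * b y) x"
proof -
  define k where "k = (a y + b y) / 2"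
  define l where "l = (k + b y) / 2"
  have kl: "a y < k" "k < l" "l < b y" using y by (auto simp: k_def l_def)
  obtain z where z: "0 < z" "z < y" "\<And>w. \<lbrakk>z \<le> w; w \<le> y\<rbrakk> \<Longrightarrow> l < b w"
    using nlc_left[OF b y(1,2) kl(3)] by blast
  define f where "f w = min k ((1 - t) * a w + t * b w) - ((1 - t) * min k (a w) + t * min k (b w))" for w
  have i: "(\<lambda>w. (1 - t) * min k (a w) + t * min k (b w)) integrable_on {0..1}"
    "(\<lambda>w. min k ((1 - t) * a w + t * b w)) integrable_on {0..1}"
    using cap_integrable[OF a, of 0 1] cap_integrable[OF b, of 0 1]
      cap_integrable[OF nlc_convex_comb[OF a b], of t 0 1] t
    by (auto intro!: integral_lincomb(1))
  have "0 < integral {0..1} f"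
  proof (rule integral_pos_if_pos_on_interval)
    show "f integrable_on {0..1}" unfolding f_def using i by (intro integrable_diff)
    show "0 \<le> f w" for w using min_concave[of t k "a w" "b w"] t by (simp add: f_def)
    show "min ((1 - t) * (k - a y)) (t * (l - k)) \<le> f w" if "z \<le> w" "w \<le> y" for w
    proof -
      have aw: "a w \<le> a y" and bw: "l < b w"
        using nlc_mono[OF a, of w y] z that y by auto
      have "(1 - t) * (k - a y) \<le> (1 - t) * (k - a w)" "t * (l - k) \<le> t * (b w - k)"
        using aw bw t by (auto intro!: mult_left_mono)
      \<comment> \<open>Truncation fixes \<open>a w\<close> and sends \<open>b w\<close> to
        \<open>k\<close>; the gain depends on which side of \<open>k\<close> the mixture
        falls.\<close>
      moreover have "f w = min ((1 - t) * (k - a w)) (t * (b w - k))"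
      proof (cases "k \<le> (1 - t) * a w + t * b w")
        case True
        then have "(1 - t) * (k - a w) \<le> t * (b w - k)" by (simp add: algebra_simps)
        with True show ?thesis using aw bw kl by (simp add: f_def min_absorb1 min_absorb2 algebra_simps)
      next
        case False
        then have "t * (b w - k) \<le> (1 - t) * (k - a w)" by (simp add: algebra_simps)
        with False show ?thesis using aw bw kl by (simp add: f_def min_absorb1 min_absorb2 algebra_simps)
      qed
      ultimately show ?thesis by linarith
    qed
    show "0 < min ((1 - t) * (k - a y)) (t * (l - k))" using t kl by simp
  qed (use z y in auto)
  then have "(1 - t) * cap a (1 - k) + t * cap b (1 - k) < cap (\<lambda>y. (1 - t) * a y + t * b y) (1 - k)"
    unfolding f_def cap_def using i cap_integrable[OF a, of 0 1 k] cap_integrable[OF b, of 0 1 k]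
    by (simp add: Henstock_Kurzweil_Integration.integral_diff integral_lincomb(2))
  moreover have "0 \<le> k" "k \<le> 1" using nlc_range[OF a, of y] nlc_range[OF b, of y] y by (auto simp: k_def)
  ultimately show thesis by (intro that[of "1 - k"]) auto
qed

section \<open>Pairs with binding constraint are extreme\<close>

lemma majorization_pairsE:
  assumes "p \<in> majorization_pairs"
  obtains p1 p2 where "p = (ae_class p1, ae_class p2)"
    "p1 \<in> nondecr_left_cont" "p2 \<in> nondecr_left_cont"
    "\<And>x. \<lbrakk>0 \<le> x; x \<le> 1\<rbrakk> \<Longrightarrow> tail p1 x \<le> cap p2 x" "tail p1 0 = cap p2 0"
  using assms majorized_by_conjugate_iff unfolding majorization_pairs_def by fastforce

lemma majorization_pairsI:
  assumes "p1 \<in> nondecr_left_cont" "p2 \<in> nondecr_left_cont"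
    "\<And>x. \<lbrakk>0 \<le> x; x \<le> 1\<rbrakk> \<Longrightarrow> tail p1 x \<le> cap p2 x" "tail p1 0 = cap p2 0"
  shows "(ae_class p1, ae_class p2) \<in> majorization_pairs"
proof -
  have "p1 \<preceq> conjugate p2" using assms majorized_by_conjugate_iff by simp
  then show ?thesis using assms unfolding majorization_pairs_def by blast
qed

lemma extreme_point_if_conjugate:
  assumes q1: "q1 \<in> nondecr_left_cont" and q2: "q2 \<in> nondecr_left_cont"
    and eq: "ae_class q1 = ae_class (conjugate q2)"
  shows "(ae_class q1, ae_class q2) extreme_point_of majorization_pairs"
proof -
  have tc: "tail q1 x = cap q2 x" if "0 \<le> x" "x \<le> 1" for x
    using tail_eq_if_ae_class_eq[OF eq] tail_conjugate[OF q2] that by simp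
  have False if a: "a \<in> majorization_pairs" and b: "b \<in> majorization_pairs"
    and seg: "(ae_class q1, ae_class q2) \<in> open_segment a b" for a b
  proof -
    obtain a1 a2 where a: "a = (ae_class a1, ae_class a2)"
      "a1 \<in> nondecr_left_cont" "a2 \<in> nondecr_left_cont"
      "\<And>x. \<lbrakk>0 \<le> x; x \<le> 1\<rbrakk> \<Longrightarrow> tail a1 x \<le> cap a2 x" using majorization_pairsE[OF a] by metis
    obtain b1 b2 where b: "b = (ae_class b1, ae_class b2)"
      "b1 \<in> nondecr_left_cont" "b2 \<in> nondecr_left_cont"
      "\<And>x. \<lbrakk>0 \<le> x; x \<le> 1\<rbrakk> \<Longrightarrow> tail b1 x \<le> cap b2 x" using majorization_pairsE[OF b] by metis
    obtain t where ab: "a \<noteq> b" and t: "0 < t" "t < 1"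
      and "(ae_class q1, ae_class q2) = (1 - t) *\<^sub>R a + t *\<^sub>R b"
      using seg by (auto simp: in_segment)
    then have c: "ae_class q1 = ae_class (\<lambda>x. (1 - t) * a1 x + t * b1 x)"
      "ae_class q2 = ae_class (\<lambda>x. (1 - t) * a2 x + t * b2 x)"
      by (auto simp: a b ae_class_convex_comb)
    have cap2: "cap q2 x = cap (\<lambda>y. (1 - t) * a2 y + t * b2 y) x" for x
    proof -
      have "q2 y = (1 - t) * a2 y + t * b2 y" if "0 < y" "y \<le> 1" for y
        using nlc_eq_if_ae_class_eq[OF q2 nlc_convex_comb c(2)] a b t that by simp
      then show ?thesis unfolding cap_def by (intro integral_spike[of "{0}"]) auto
    qed
    have tail1: "tail q1 x = (1 - t) * tail a1 x + t * tail b1 x" if "0 \<le> x" for x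
      unfolding tail_eq_if_ae_class_eq[OF c(1) that] unfolding tail_def
      by (intro integral_lincomb(2) nlc_integrable a b that) simp_all
    have le: "(1 - t) * cap a2 x + t * cap b2 x \<le> cap q2 x" for x
      unfolding cap2 using cap_convex_comb_le[OF a(3) b(3)] t by simp
    \<comment> \<open>A sandwich: the mixed tails equal \<open>cap q2 x\<close>, which dominates the
      mixed caps, and these dominate the mixed tails. Since both weights are positive, each
      inequality is an equality.\<close>
    have eqs: "tail a1 x = cap a2 x \<and> tail b1 x = cap b2 x \<and> (1 - t) * cap a2 x + t * cap b2 x = cap q2 x"
      if x: "0 \<le> x" "x \<le> 1" for x
    proof -
      have "0 \<le> (1 - t) * (cap a2 x - tail a1 x)" "0 \<le> t * (cap b2 x - tail b1 x)"
        using a(4)[OF x] b(4)[OF x] t by auto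
      moreover have "(1 - t) * (cap a2 x - tail a1 x) + t * (cap b2 x - tail b1 x) \<le> 0"
        using le[of x] tc[OF x] tail1[OF x(1)] by (simp add: algebra_simps)
      ultimately have "(1 - t) * (cap a2 x - tail a1 x) = 0" "t * (cap b2 x - tail b1 x) = 0" by linarith+
      then have "tail a1 x = cap a2 x" "tail b1 x = cap b2 x" using t by auto
      then show ?thesis using tc[OF x] tail1[OF x(1)] by simp
    qed
    have 2: "a2 y = b2 y" if y: "0 < y" "y \<le> 1" for y
    proof (rule ccontr)
      assume "a2 y \<noteq> b2 y"
      then consider "a2 y < b2 y" | "b2 y < a2 y" by linarith
      then show False
      proof cases
        case 1
        then show False using cap_convex_comb_less[OF a(3) b(3) t y] eqs cap2 by (metis less_irrefl)
      next
        case 2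
        \<comment> \<open>\<open>cap_convex_comb_less\<close> takes the smaller function first, so
          the two parts are exchanged along with their weights.\<close>
        have t': "0 < 1 - t" "1 - t < 1" using t by auto
        obtain x where x: "0 \<le> x" "x \<le> 1" "(1 - (1 - t)) * cap b2 x + (1 - t) * cap a2 x
            < cap (\<lambda>y. (1 - (1 - t)) * b2 y + (1 - t) * a2 y) x"
          using cap_convex_comb_less[OF b(3) a(3) t' y 2] by blast
        then show False using eqs[of x] cap2[of x] by (simp add: add.commute)
      qed
    qed
    then have "cap a2 x = cap b2 x" for x
      unfolding cap_def by (intro integral_spike[of "{0}"]) auto
    then have "a1 y = b1 y" if "0 < y" "y \<le> 1" for y
      using nlc_eq_if_tail_eq[OF a(2) b(2) _ that] eqs by simp
    with 2 have "a = b" unfolding a(1) b(1) by (auto intro: ae_class_eqI)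
    with ab show False by simp
  qed
  moreover have "(ae_class q1, ae_class q2) \<in> majorization_pairs"
    using q1 q2 tc by (intro majorization_pairsI) auto
  ultimately show ?thesis unfolding extreme_point_of_def by blast
qed

section \<open>Tent perturbations of the values of a function\<close>

definition tent :: "real \<Rightarrow> real \<Rightarrow> real \<Rightarrow> real" where
  "tent a b w = max 0 (min (w - a) (b - w))"

lemma tent_nonneg: "0 \<le> tent a b w"
  by (simp add: tent_def)

lemma tent_outside: "w \<le> a \<or> b \<le> w \<Longrightarrow> tent a b w = 0"
  by (auto simp: tent_def)

lemma tent_scaled:
  assumes "\<bar>d\<bar> \<le> 1"
  shows "\<bar>d * tent a b w\<bar> \<le> tent a b w"
  using assms tent_nonneg[of a b w] by (simp add: abs_mult mult_left_le_one_le)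

text \<open>The tent has slopes 1, -1 and 0 only, so a multiple with factor at most 1 in modulus
  cannot reverse the order of values. This is why a function perturbed by a tent of its own values
  stays nondecreasing.\<close>

lemma tent_lipschitz:
  assumes "\<bar>d\<bar> \<le> 1" "v \<le> w"
  shows "v + d * tent a b v \<le> w + d * tent a b w"
proof -
  have "\<bar>tent a b w - tent a b v\<bar> \<le> w - v" using assms(2) by (auto simp: tent_def)
  moreover have "\<bar>d * (tent a b w - tent a b v)\<bar> \<le> \<bar>tent a b w - tent a b v\<bar>"
    using assms(1) by (simp add: abs_mult mult_left_le_one_le)
  ultimately show ?thesis by (simp add: algebra_simps)
qed

lemma tent_perturb_nlc:
  assumes q: "q \<in> nondecr_left_cont" and ab: "0 \<le> a" "b \<le> 1" and d: "\<bar>d\<bar> \<le> 1"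
  shows "(\<lambda>x. q x + d * tent a b (q x)) \<in> nondecr_left_cont"
proof -
  have "0 \<le> q x + d * tent a b (q x) \<and> q x + d * tent a b (q x) \<le> 1" if "0 \<le> x" "x \<le> 1" for x
  proof -
    have "tent a b (q x) \<le> q x" "tent a b (q x) \<le> 1 - q x"
      using nlc_range[OF q that] ab by (auto simp: tent_def)
    then show ?thesis using tent_scaled[OF d, of a b "q x"] by linarith
  qed
  moreover have "q x + d * tent a b (q x) \<le> q y + d * tent a b (q y)"
    if "0 \<le> x" "x \<le> y" "y \<le> 1" for x y
    using tent_lipschitz[OF d nlc_mono[OF q that]] .
  moreover have "continuous (at_left x) (\<lambda>x. q x + d * tent a b (q x))" if "x \<in> {0<..1}" for x
    using q that unfolding nondecr_left_cont_def tent_def by (intro continuous_intros) auto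
  ultimately show ?thesis unfolding nondecr_left_cont_def by (auto intro!: mono_onI)
qed

lemma tent_integrable:
  assumes q: "q \<in> nondecr_left_cont" and ab: "0 \<le> a" "b \<le> 1" and xy: "0 \<le> x" "y \<le> 1"
  shows "(\<lambda>x. tent a b (q x)) integrable_on {x..y}"
proof -
  have "(\<lambda>x. (q x + 1 * tent a b (q x)) - q x) integrable_on {x..y}"
    using nlc_integrable[OF tent_perturb_nlc[OF q ab, of 1] xy] nlc_integrable[OF q xy]
    by (intro integrable_diff) auto
  then show ?thesis by simp
qed

lemma tent_integral_pos:
  assumes q: "q \<in> nondecr_left_cont" and ab: "0 \<le> a" "b \<le> 1"
    and x: "0 < x" "x \<le> 1" "a < q x" "q x < b"
  shows "0 < integral {0..1} (\<lambda>x. tent a b (q x))"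
proof -
  define l where "l = (a + q x) / 2"
  have l: "a < l" "l < q x" using x by (auto simp: l_def)
  obtain y where y: "0 < y" "y < x" "\<And>z. \<lbrakk>y \<le> z; z \<le> x\<rbrakk> \<Longrightarrow> l < q z"
    using nlc_left[OF q x(1,2) l(2)] by blast
  show ?thesis
  proof (rule integral_pos_if_pos_on_interval)
    show "(\<lambda>x. tent a b (q x)) integrable_on {0..1}" by (rule tent_integrable[OF q ab]) auto
    show "0 \<le> tent a b (q x)" for x by (rule tent_nonneg)
    show "min (l - a) (b - q x) \<le> tent a b (q z)" if z: "y \<le> z" "z \<le> x" for z
      using nlc_mono[OF q, of z x] y(3)[OF z] z x y(1) by (auto simp: tent_def)
  qed (use l x y in auto)
qed

text \<open>The perturbation maps the interval from \<open>a\<close> to \<open>b\<close> into itself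
  and fixes all other points. Truncation at or below \<open>a\<close> therefore does not see it, and
  truncation at or above \<open>b\<close> leaves it intact. At any level the truncated value drops
  by no more than the negative part of the change.\<close>

lemma min_tent_perturb:
  fixes d k w :: real
  assumes d: "\<bar>d\<bar> \<le> 1"
  shows "k \<le> a \<Longrightarrow> min k (w + d * tent a b w) = min k w"
    and "b \<le> k \<Longrightarrow> min k (w + d * tent a b w) = min k w + d * tent a b w"
    and "min k w + min 0 d * tent a b w \<le> min k (w + d * tent a b w)"
proof -
  note s = tent_scaled[OF d, of a b w]
  consider "w \<le> a \<or> b \<le> w" | "a < w" "w < b" by linarith
  then have "(k \<le> a \<longrightarrow> min k (w + d * tent a b w) = min k w) \<and>
    (b \<le> k \<longrightarrow> min k (w + d * tent a b w) = min k w + d * tent a b w)"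
  proof cases
    case 2
    then have "tent a b w \<le> w - a" "tent a b w \<le> b - w" by (auto simp: tent_def)
    then show ?thesis using s 2 by auto
  qed (simp add: tent_outside)
  then show "k \<le> a \<Longrightarrow> min k (w + d * tent a b w) = min k w"
    and "b \<le> k \<Longrightarrow> min k (w + d * tent a b w) = min k w + d * tent a b w" by auto
  have "min 0 d * tent a b w \<le> d * tent a b w" "min 0 d * tent a b w \<le> 0"
    using tent_nonneg[of a b w] by (auto intro!: mult_right_mono mult_nonpos_nonneg)
  then show "min k w + min 0 d * tent a b w \<le> min k (w + d * tent a b w)" by linarith
qed

lemma cap_concave:
  assumes q: "q \<in> nondecr_left_cont" and abx: "0 \<le> a" "a \<le> x" "x \<le> b" "b \<le> 1"
  shows "(b - x) * cap q a + (x - a) * cap q b \<le> (b - a) * cap q x"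
  using tail_concave[OF nlc_mono_on[OF conjugate_nlc[of q]] abx] abx tail_conjugate[OF q] by simp

text \<open>
  On \<open>{s<..m}\<close> the tail of \<open>q1\<close> is affine and the cap is concave, so the majorization constraint for
  the perturbed pair need only be checked at \<open>s\<close> and \<open>m\<close>; on \<open>{m..<t}\<close> the slack \<open>e\<close> absorbs
  the perturbation, and elsewhere both sides of the constraint move by the same amount.
\<close>

lemma not_extreme_if_tent_perturb:
  assumes q1: "q1 \<in> nondecr_left_cont" and q2: "q2 \<in> nondecr_left_cont"
    and le: "\<And>x. \<lbrakk>0 \<le> x; x \<le> 1\<rbrakk> \<Longrightarrow> tail q1 x \<le> cap q2 x" and eq: "tail q1 0 = cap q2 0"
    and ab: "0 \<le> a" "b \<le> 1" and st: "0 \<le> s" "s \<le> m" "m \<le> t" "t \<le> 1"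
    and low: "\<And>x. \<lbrakk>0 \<le> x; x \<le> s\<rbrakk> \<Longrightarrow> q1 x \<le> a"
    and high: "\<And>x. \<lbrakk>t < x; x \<le> 1\<rbrakk> \<Longrightarrow> b \<le> q1 x"
    and const: "\<And>x. \<lbrakk>s < x; x \<le> m\<rbrakk> \<Longrightarrow> q1 x = c"
    and slack: "\<And>x. \<lbrakk>m \<le> x; x < t\<rbrakk> \<Longrightarrow> tail q1 x + e \<le> cap q2 x" "0 < e"
    and x0: "0 < x0" "x0 \<le> 1" "a < q1 x0" "q1 x0 < b"
    and y0: "0 < y0" "y0 \<le> 1" "1 - t < q2 y0" "q2 y0 < 1 - s"
  shows "\<not> (ae_class q1, ae_class q2) extreme_point_of majorization_pairs"
proof -
  \<comment> \<open>The value window of \<open>q2\<close> runs from \<open>1 - t\<close> to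
    \<open>1 - s\<close> because the cap at \<open>x\<close> truncates at \<open>1 - x\<close>: caps
    at \<open>x\<close> beyond \<open>t\<close> ignore the move, and caps at \<open>x\<close> before
    \<open>s\<close> feel all of it.\<close>
  define u where "u x = tent a b (q1 x)" for x
  define v where "v y = tent (1 - t) (1 - s) (q2 y)" for y
  define U where "U = integral {0..1} u"
  define V where "V = integral {0..1} v"
  have ts: "0 \<le> 1 - t" "1 - s \<le> 1" using st by auto
  have U: "0 < U" unfolding U_def u_def by (rule tent_integral_pos[OF q1 ab x0])
  have V: "0 < V" unfolding V_def v_def by (rule tent_integral_pos[OF q2 ts y0])
  have ui: "u integrable_on {x..y}" if "0 \<le> x" "y \<le> 1" for x y
    unfolding u_def by (rule tent_integrable[OF q1 ab that])
  have vi: "v integrable_on {x..y}" if "0 \<le> x" "y \<le> 1" for x y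
    unfolding v_def by (rule tent_integrable[OF q2 ts that])
  \<comment> \<open>\<open>N\<close> is the mass moved in each component. The bounds by
    \<open>U\<close> and \<open>V\<close> make the scaling factors at most 1; the bound by
    \<open>e\<close> fits the move into the slack.\<close>
  define N where "N = min e (min U V)"
  have N: "0 < N" "N \<le> e" "N \<le> U" "N \<le> V" using slack(2) U V by (auto simp: N_def)
  define r1 where "r1 \<sigma> x = q1 x + \<sigma> * (N / U) * u x" for \<sigma> x
  define r2 where "r2 \<sigma> y = q2 y + \<sigma> * (N / V) * v y" for \<sigma> y
  define S :: "real set" where "S = {1, -1}"
  have small: "\<bar>\<sigma> * (N / U)\<bar> \<le> 1" "\<bar>\<sigma> * (N / V)\<bar> \<le> 1" if "\<sigma> \<in> S" for \<sigma>
    using that N U V by (auto simp: S_def abs_mult)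
  have r1: "r1 \<sigma> \<in> nondecr_left_cont" and r2: "r2 \<sigma> \<in> nondecr_left_cont" if "\<sigma> \<in> S" for \<sigma>
    using tent_perturb_nlc[OF q1 ab small(1)[OF that]] tent_perturb_nlc[OF q2 ts small(2)[OF that]]
    by (simp_all add: r1_def[abs_def] r2_def[abs_def] u_def v_def)
  have tail_r1: "tail (r1 \<sigma>) x = tail q1 x + \<sigma> * (N / U) * tail u x" if "0 \<le> x" for \<sigma> x
    using integral_lincomb(2)[OF nlc_integrable[OF q1 that order_refl] ui[OF that order_refl], of 1 "\<sigma> * (N / U)"]
    by (simp add: tail_def r1_def[abs_def])
  have u0: "0 \<le> u x" for x by (simp add: u_def tent_nonneg)
  have tail_u: "0 \<le> tail u x" "tail u x \<le> U" if "0 \<le> x" "x \<le> 1" for x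
  proof -
    show "0 \<le> tail u x" unfolding tail_def by (rule integral_nonneg) (use ui that u0 in auto)
    show "tail u x \<le> U" unfolding tail_def U_def by (rule integral_subset_le) (use ui that u0 in auto)
  qed
  have cap_r2: "cap (r2 \<sigma>) x = integral {0..1} (\<lambda>y. min (1 - x) (q2 y + \<sigma> * (N / V) * v y))" for \<sigma> x
    by (simp add: cap_def r2_def)
  have cap_shift: "integral {0..1} (\<lambda>y. min (1 - x) (q2 y) + h * v y) = cap q2 x + h * V"
    "(\<lambda>y. min (1 - x) (q2 y) + h * v y) integrable_on {0..1}" for h x
    using integral_lincomb[OF cap_integrable[OF q2, of 0 1 "1 - x"] vi[of 0 1], of 1 h]
    by (simp_all add: cap_def V_def)
  \<comment> \<open>Past \<open>t\<close> neither side moves: \<open>q1\<close> is at least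
    \<open>b\<close> there, and the truncation level is at most \<open>1 - t\<close>.\<close>
  have right: "tail (r1 \<sigma>) x = tail q1 x \<and> cap (r2 \<sigma>) x = cap q2 x"
    if "\<sigma> \<in> S" "t \<le> x" "x \<le> 1" for \<sigma> x
  proof -
    have "u w = 0" if "x < w" "w < 1" for w
      using high[of w] that \<open>t \<le> x\<close> by (simp add: u_def tent_outside)
    then have "tail u x = 0"
      using integral_bounds[OF ui[of x 1], of 0 0] that st by (simp add: tail_def)
    moreover have "cap (r2 \<sigma>) x = cap q2 x"
      unfolding cap_def r2_def v_def using min_tent_perturb(1)[OF small(2)[OF that(1)]] that by simp
    ultimately show ?thesis using tail_r1 that st by simp
  qed
  \<comment> \<open>Before \<open>s\<close> both sides move by the whole mass: \<open>u\<close>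
    vanishes to the left of \<open>x\<close>, and the truncation level is at least
    \<open>1 - s\<close>.\<close>
  have left: "tail (r1 \<sigma>) x = tail q1 x + \<sigma> * N \<and> cap (r2 \<sigma>) x = cap q2 x + \<sigma> * N"
    if "\<sigma> \<in> S" "0 \<le> x" "x \<le> s" for \<sigma> x
  proof -
    have "u w = 0" if "0 < w" "w < x" for w
      using low[of w] that \<open>x \<le> s\<close> by (simp add: u_def tent_outside)
    then have "integral {0..x} u = 0"
      using integral_bounds[OF ui[of 0 x], of 0 0] that st by simp
    then have "tail u x = U"
      using tail_diff[OF ui[of 0 1], of 0 x] that st by (simp add: tail_def U_def)
    moreover have "cap (r2 \<sigma>) x = cap q2 x + \<sigma> * (N / V) * V"
      unfolding cap_r2 cap_shift(1)[symmetric] v_def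
      using min_tent_perturb(2)[OF small(2)[OF that(1)]] that by simp
    ultimately show ?thesis using tail_r1 that U V by simp
  qed
  \<comment> \<open>The tail rises by at most \<open>max 0 \<sigma> * N\<close> and the cap drops by
    at most \<open>- min 0 \<sigma> * N\<close>. For a sign these add up to \<open>N\<close>, which
    the slack \<open>e\<close> covers.\<close>
  have middle: "tail (r1 \<sigma>) x \<le> cap (r2 \<sigma>) x" if \<sigma>: "\<sigma> \<in> S" and x: "m \<le> x" "x < t" for \<sigma> x
  proof -
    have x01: "0 \<le> x" "x \<le> 1" using x st by auto
    have "cap q2 x + min 0 (\<sigma> * (N / V)) * V \<le> cap (r2 \<sigma>) x"
      unfolding cap_r2 cap_shift(1)[symmetric]
    proof (rule integral_le)
      show "(\<lambda>y. min (1 - x) (q2 y + \<sigma> * (N / V) * v y)) integrable_on {0..1}"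
        using cap_integrable[OF r2[OF \<sigma>], of 0 1] by (simp add: r2_def)
    qed (use cap_shift(2) min_tent_perturb(3)[OF small(2)[OF \<sigma>]] in \<open>auto simp: v_def\<close>)
    moreover have "min 0 (\<sigma> * (N / V)) * V = min 0 \<sigma> * N"
      using \<sigma> V N by (auto simp: S_def)
    moreover have "\<sigma> * (N / U) * tail u x \<le> max 0 \<sigma> * N"
    proof -
      have "(N / U) * tail u x \<le> (N / U) * U" using tail_u[OF x01] N U by (intro mult_left_mono) auto
      moreover have "0 \<le> (N / U) * tail u x" using tail_u[OF x01] N U by auto
      ultimately show ?thesis using \<sigma> U by (auto simp: S_def)
    qed
    moreover have "max 0 \<sigma> * N - min 0 \<sigma> * N = N" using \<sigma> by (auto simp: S_def)
    ultimately show ?thesis using slack(1)[OF x] tail_r1[OF x01(1), of \<sigma>] N by linarith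
  qed
  have r_le: "tail (r1 \<sigma>) x \<le> cap (r2 \<sigma>) x" if \<sigma>: "\<sigma> \<in> S" and x: "0 \<le> x" "x \<le> 1" for \<sigma> x
  proof -
    have L: "tail (r1 \<sigma>) x \<le> cap (r2 \<sigma>) x" if "x \<le> s" "0 \<le> x" for x
      using left[OF \<sigma> that(2,1)] le[of x] st that by simp
    have R: "tail (r1 \<sigma>) x \<le> cap (r2 \<sigma>) x" if "m \<le> x" "x \<le> 1" for x
      using right[OF \<sigma>, of x] middle[OF \<sigma>, of x] le[of x] st that by (cases "t \<le> x") auto
    consider "x \<le> s" | "m \<le> x" | "s < x" "x < m" by linarith
    then show ?thesis
    proof cases
      case 3
      define k where "k = r1 \<sigma> m"
      \<comment> \<open>The perturbation depends on the value of \<open>q1\<close> only, so it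
        preserves the plateau on \<open>{s<..m}\<close>.\<close>
      have k: "r1 \<sigma> z = k" if "s < z" "z \<le> m" for z
        using const[OF that] const[of m] 3 by (simp add: k_def r1_def u_def)
      have ri: "r1 \<sigma> integrable_on {y..z}" if "0 \<le> y" "z \<le> 1" for y z
        using nlc_integrable[OF r1[OF \<sigma>] that] .
      have "tail (r1 \<sigma>) s - tail (r1 \<sigma>) x = (x - s) * k"
        "tail (r1 \<sigma>) x - tail (r1 \<sigma>) m = (m - x) * k"
        using integral_bounds[OF ri[of s x], of k k] integral_bounds[OF ri[of x m], of k k]
          tail_diff[OF ri[of 0 1], of s x] tail_diff[OF ri[of 0 1], of x m] k 3 st by auto
      then have ends: "tail (r1 \<sigma>) s = tail (r1 \<sigma>) x + (x - s) * k"
        "tail (r1 \<sigma>) m = tail (r1 \<sigma>) x - (m - x) * k" by auto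
      have "(m - s) * tail (r1 \<sigma>) x = (m - x) * tail (r1 \<sigma>) s + (x - s) * tail (r1 \<sigma>) m"
        unfolding ends by (simp add: algebra_simps)
      also have "\<dots> \<le> (m - x) * cap (r2 \<sigma>) s + (x - s) * cap (r2 \<sigma>) m"
        using L[of s] R[of m] 3 st by (intro add_mono mult_left_mono) auto
      also have "\<dots> \<le> (m - s) * cap (r2 \<sigma>) x"
        using cap_concave[OF r2[OF \<sigma>], of s x m] 3 st by auto
      finally show ?thesis using 3 by (simp add: mult_le_cancel_left)
    qed (use L R x in auto)
  qed
  define P where "P \<sigma> = (ae_class (r1 \<sigma>), ae_class (r2 \<sigma>))" for \<sigma>
  have P: "P \<sigma> \<in> majorization_pairs" if "\<sigma> \<in> S" for \<sigma>
    unfolding P_def using r1[OF that] r2[OF that] r_le[OF that] left[OF that, of 0] st eq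
    by (intro majorization_pairsI) auto
  have S: "1 \<in> S" "-1 \<in> S" by (auto simp: S_def)
  have "P 1 \<noteq> P (-1)"
  proof
    assume "P 1 = P (-1)"
    then have "ae_class (r1 1) = ae_class (r1 (-1))" by (simp add: P_def)
    then have "tail (r1 1) 0 = tail (r1 (-1)) 0" by (rule tail_eq_if_ae_class_eq) simp
    then show False using left[OF S(1), of 0] left[OF S(2), of 0] N st by simp
  qed
  moreover have "(ae_class q1, ae_class q2) = (1 - 1/2) *\<^sub>R P 1 + (1/2) *\<^sub>R P (-1)"
    by (simp add: P_def ae_class_convex_comb r1_def r2_def field_simps)
  ultimately have "(ae_class q1, ae_class q2) \<in> open_segment (P 1) (P (-1))"
    unfolding in_segment by (intro conjI exI[of _ "1/2"]) auto
  then show ?thesis using P S unfolding extreme_point_of_def by blast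
qed

section \<open>Maximal intervals of slackness\<close>

lemma zero_free_component:
  fixes C :: "real \<Rightarrow> real"
  assumes C: "continuous_on {0..1} C" "C 0 = 0" "C 1 = 0" and z: "0 \<le> z" "z \<le> 1" "C z \<noteq> 0"
  obtains a b where "0 \<le> a" "a < z" "z < b" "b \<le> 1" "C a = 0" "C b = 0"
    "\<And>x. \<lbrakk>a < x; x < b\<rbrakk> \<Longrightarrow> C x \<noteq> 0"
proof -
  have cl: "closed {x \<in> {l..u}. C x = 0}" if "0 \<le> l" "u \<le> 1" for l u
    using that by (intro continuous_closed_preimage_constant continuous_on_subset[OF C(1)]) auto
  have co: "compact {x \<in> {l..u}. C x = 0}" if "0 \<le> l" "u \<le> 1" for l u
    unfolding compact_eq_bounded_closed
    by (intro conjI cl that bounded_subset[OF bounded_closed_interval[of l u]]) auto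
  \<comment> \<open>The endpoints are the zeros of \<open>C\<close> nearest to \<open>z\<close> on
    either side; they exist by compactness of the zero set.\<close>
  have "{x \<in> {0..z}. C x = 0} \<noteq> {}" using C z by auto
  then obtain a where a: "a \<in> {0..z}" "C a = 0" "\<forall>x\<in>{x \<in> {0..z}. C x = 0}. x \<le> a"
    using compact_attains_sup[OF co[of 0 z]] z by auto
  have "{x \<in> {z..1}. C x = 0} \<noteq> {}" using C z by auto
  then obtain b where b: "b \<in> {z..1}" "C b = 0" "\<forall>x\<in>{x \<in> {z..1}. C x = 0}. b \<le> x"
    using compact_attains_inf[OF co[of z 1]] z by auto
  have "a \<noteq> z" "b \<noteq> z" using a b z by auto
  moreover have "C x \<noteq> 0" if x: "a < x" "x < b" for x
  proof
    assume "C x = 0"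
    then have "x \<in> {x \<in> {0..z}. C x = 0} \<or> x \<in> {x \<in> {z..1}. C x = 0}" using x a b by auto
    then show False using x a(3) b(3) by (meson not_le)
  qed
  ultimately show thesis using a b by (intro that[of a b]) auto
qed

text \<open>If \<open>q2\<close> had no value strictly between \<open>1 - b\<close> and
  \<open>1 - a\<close>, each truncated value would be affine in the level there, so the cap would be
  affine on \<open>{a..b}\<close>. The concave tail meets it at both ends and would lie above it at
  \<open>z\<close>.\<close>

lemma value_strictly_between_if_slack:
  assumes q1: "q1 \<in> nondecr_left_cont" and q2: "q2 \<in> nondecr_left_cont"
    and ab: "0 \<le> a" "b \<le> 1" and z: "a < z" "z < b"
    and ends: "tail q1 a = cap q2 a" "tail q1 b = cap q2 b" and slack: "tail q1 z < cap q2 z"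
  obtains y where "0 < y" "y \<le> 1" "1 - b < q2 y" "q2 y < 1 - a"
proof -
  have "\<exists>y. 0 < y \<and> y \<le> 1 \<and> 1 - b < q2 y \<and> q2 y < 1 - a"
  proof (rule ccontr)
    assume *: "\<not> ?thesis"
    have pt: "(b - z) * min (1 - a) w + (z - a) * min (1 - b) w = (b - a) * min (1 - z) w"
      if "w \<le> 1 - b \<or> 1 - a \<le> w" for w
      using that
    proof
      assume "w \<le> 1 - b"
      then show ?thesis using z by (simp add: min_absorb2 algebra_simps)
    next
      assume "1 - a \<le> w"
      then show ?thesis using z by (simp add: min_absorb1 algebra_simps)
    qed
    have "(b - z) * cap q2 a + (z - a) * cap q2 b
        = integral {0..1} (\<lambda>y. (b - z) * min (1 - a) (q2 y) + (z - a) * min (1 - b) (q2 y))"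
      unfolding cap_def by (intro integral_lincomb(2)[symmetric] cap_integrable q2) auto
    also have "\<dots> = integral {0..1} (\<lambda>y. (b - a) * min (1 - z) (q2 y))"
      by (rule integral_spike[of "{0}"]) (use * pt in \<open>force simp: not_less\<close>)+
    also have "\<dots> = (b - a) * cap q2 z" by (simp add: cap_def)
    finally have "(b - a) * cap q2 z \<le> (b - a) * tail q1 z"
      using tail_concave[OF nlc_mono_on[OF q1], of a z b] ab z ends by simp
    then show False using slack z by (simp add: mult_le_cancel_left)
  qed
  then show thesis using that by blast
qed

lemma tail_cap_continuous:
  assumes "q1 \<in> nondecr_left_cont" "q2 \<in> nondecr_left_cont"
  shows "continuous_on {0..1} (\<lambda>x. cap q2 x - tail q1 x)"
proof -
  have "continuous_on {0..1} (\<lambda>x. tail (conjugate q2) x - tail q1 x)"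
    unfolding tail_def
    by (intro continuous_on_diff indefinite_integral_continuous_1' nlc_integrable conjugate_nlc assms) auto
  then show ?thesis
    by (rule continuous_on_eq) (use tail_conjugate[OF assms(2)] in auto)
qed

text \<open>\<open>k\<close> is the average rate at which the cap falls from \<open>a\<close> to
  \<open>z\<close>. Left of \<open>a\<close> the concave cap falls at rate at most \<open>k\<close>,
  and so does the tail, which lies below it and touches it at \<open>a\<close>. From
  \<open>a\<close> to \<open>z\<close> the tail falls by strictly more than the cap, which forces
  \<open>q1 z\<close> above \<open>k\<close>.\<close>

lemma left_values_bounded_if_slack:
  assumes q1: "q1 \<in> nondecr_left_cont" and q2: "q2 \<in> nondecr_left_cont"
    and le: "\<And>x. \<lbrakk>0 \<le> x; x \<le> 1\<rbrakk> \<Longrightarrow> tail q1 x \<le> cap q2 x"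
    and az: "0 \<le> a" "a < z" "z \<le> 1" and "tail q1 a = cap q2 a" "tail q1 z < cap q2 z"
  obtains k where "0 \<le> k" "k < q1 z" "\<And>x. \<lbrakk>0 < x; x \<le> a\<rbrakk> \<Longrightarrow> q1 x \<le> k"
proof -
  define k where "k = (cap q2 a - cap q2 z) / (z - a)"
  have k: "cap q2 a - cap q2 z = (z - a) * k" using az by (simp add: k_def)
  have "(z - a) * 0 \<le> (z - a) * conjugate q2 a"
    using nlc_range[OF conjugate_nlc[of q2], of a] az by (intro mult_left_mono) auto
  also have "\<dots> \<le> (z - a) * k" using cap_diff_bounds(1)[OF q2, of a z] k az by simp
  finally have "0 \<le> k" using az by (simp add: zero_le_mult_iff)
  moreover have "(z - a) * k < (z - a) * q1 z"
    using tail_diff_bounds(2)[OF nlc_mono_on[OF q1], of a z] k assms by linarith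
  then have "k < q1 z" using az by simp
  moreover have below: "q1 x \<le> k" if x: "0 \<le> x" "x < a" for x
  proof -
    have "(z - a) * cap q2 x + (a - x) * cap q2 z \<le> (z - x) * cap q2 a"
      using cap_concave[OF q2, of x a z] x az by simp
    moreover have "(z - x) * cap q2 a = (z - a) * cap q2 a + (a - x) * cap q2 a" by (simp add: algebra_simps)
    moreover have "(a - x) * cap q2 a - (a - x) * cap q2 z = (z - a) * ((a - x) * k)"
      unfolding right_diff_distrib[symmetric] k by (rule mult.left_commute)
    ultimately have "(z - a) * (cap q2 x - cap q2 a) \<le> (z - a) * ((a - x) * k)"
      unfolding right_diff_distrib[of "z - a"] by linarith
    then have "cap q2 x - cap q2 a \<le> (a - x) * k" using az by (simp add: mult_le_cancel_left)
    moreover have "(a - x) * q1 x \<le> tail q1 x - tail q1 a"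
      using tail_diff_bounds(1)[OF nlc_mono_on[OF q1], of x a] x az by simp
    ultimately have "(a - x) * q1 x \<le> (a - x) * k" using le[of x] x az assms(7) by linarith
    then show ?thesis using x by (simp add: mult_le_cancel_left)
  qed
  \<comment> \<open>The bound reaches the point \<open>a\<close> itself by left continuity.\<close>
  moreover have "q1 a \<le> k" if pos: "0 < a"
  proof (rule ccontr)
    assume "\<not> q1 a \<le> k"
    then obtain y where y: "0 < y" "y < a" "\<And>w. \<lbrakk>y \<le> w; w \<le> a\<rbrakk> \<Longrightarrow> k < q1 w"
      using nlc_left[OF q1 pos, of k] az by auto
    then show False using below[of y] y(3)[OF order_refl less_imp_le[OF y(2)]] y(1,2) by linarith
  qed
  ultimately show thesis by (intro that[of k]) (auto simp: le_less)
qed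

text \<open>The mirror image, with \<open>k\<close> the rate of the cap from \<open>z\<close> to
  \<open>b\<close>. The bound starts strictly after \<open>b\<close>, since \<open>q1 b\<close> is a
  limit of values before \<open>b\<close>.\<close>

lemma right_values_bounded_if_slack:
  assumes q1: "q1 \<in> nondecr_left_cont" and q2: "q2 \<in> nondecr_left_cont"
    and le: "\<And>x. \<lbrakk>0 \<le> x; x \<le> 1\<rbrakk> \<Longrightarrow> tail q1 x \<le> cap q2 x"
    and zb: "0 \<le> z" "z < b" "b \<le> 1" and "tail q1 b = cap q2 b" "tail q1 z < cap q2 z"
  obtains k where "k \<le> 1" "q1 z < k" "\<And>x. \<lbrakk>b < x; x \<le> 1\<rbrakk> \<Longrightarrow> k \<le> q1 x"
proof -
  define k where "k = (cap q2 z - cap q2 b) / (b - z)"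
  have k: "cap q2 z - cap q2 b = (b - z) * k" using zb by (simp add: k_def)
  have "(b - z) * k \<le> (b - z) * conjugate q2 b" using cap_diff_bounds(2)[OF q2, of z b] k zb by simp
  also have "\<dots> \<le> (b - z) * 1"
    using nlc_range[OF conjugate_nlc[of q2], of b] zb by (intro mult_left_mono) auto
  finally have "k \<le> 1" using zb by (simp add: mult_le_cancel_left)
  moreover have "(b - z) * q1 z < (b - z) * k"
    using tail_diff_bounds(1)[OF nlc_mono_on[OF q1], of z b] k assms by linarith
  then have "q1 z < k" using zb by simp
  moreover have "k \<le> q1 x" if x: "b < x" "x \<le> 1" for x
  proof -
    have "(x - b) * cap q2 z + (b - z) * cap q2 x \<le> (x - z) * cap q2 b"
      using cap_concave[OF q2, of z b x] x zb by simp
    moreover have "(x - z) * cap q2 b = (b - z) * cap q2 b + (x - b) * cap q2 b" by (simp add: algebra_simps)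
    moreover have "(x - b) * cap q2 z - (x - b) * cap q2 b = (b - z) * ((x - b) * k)"
      unfolding right_diff_distrib[symmetric] k by (rule mult.left_commute)
    ultimately have "(b - z) * ((x - b) * k) \<le> (b - z) * (cap q2 b - cap q2 x)"
      unfolding right_diff_distrib[of "b - z"] by linarith
    then have "(x - b) * k \<le> cap q2 b - cap q2 x" using zb by (simp add: mult_le_cancel_left)
    moreover have "tail q1 b - tail q1 x \<le> (x - b) * q1 x"
      using tail_diff_bounds(2)[OF nlc_mono_on[OF q1], of b x] x zb by simp
    ultimately have "(x - b) * k \<le> (x - b) * q1 x" using le[of x] x zb assms(7) by linarith
    then show ?thesis using x by (simp add: mult_le_cancel_left)
  qed
  ultimately show thesis by (rule that)
qed

text \<open>The cases depend on whether \<open>q1\<close> takes three values inside a maximal slack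
  interval. If so, a middle value is moved where slack is uniform. Otherwise the lowest value there,
  taken on a plateau starting at \<open>a\<close>, is moved. The normalization
  \<open>q1 0 = 0\<close> extends the bound on values up to \<open>a\<close> to the point 0.\<close>

lemma not_extreme_if_slack:
  assumes q1: "q1 \<in> nondecr_left_cont" and q2: "q2 \<in> nondecr_left_cont"
    and le: "\<And>x. \<lbrakk>0 \<le> x; x \<le> 1\<rbrakk> \<Longrightarrow> tail q1 x \<le> cap q2 x" and eq: "tail q1 0 = cap q2 0"
    and q10: "q1 0 = 0" and z: "0 \<le> z" "z \<le> 1" "tail q1 z < cap q2 z"
  shows "\<not> (ae_class q1, ae_class q2) extreme_point_of majorization_pairs"
proof -
  define C where "C x = cap q2 x - tail q1 x" for x
  have Cc: "continuous_on {0..1} C" unfolding C_def by (rule tail_cap_continuous[OF q1 q2])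
  have "tail q1 1 = cap q2 1" using tail_conjugate[OF q2, of 1] by (simp add: tail_def)
  then obtain a b where ab: "0 \<le> a" "a < z" "z < b" "b \<le> 1" and C0: "C a = 0" "C b = 0"
    and "\<And>x. \<lbrakk>a < x; x < b\<rbrakk> \<Longrightarrow> C x \<noteq> 0"
    using zero_free_component[OF Cc, of z] eq z by (auto simp: C_def)
  then have Cpos: "0 < C x" if "a < x" "x < b" for x
    using le[of x] that ab by (fastforce simp: C_def)
  have ends: "tail q1 a = cap q2 a" "tail q1 b = cap q2 b" using C0 by (simp_all add: C_def)
  have slack: "\<exists>e>0. \<forall>x\<in>{s..t}. tail q1 x + e \<le> cap q2 x" if "a < s" "s \<le> t" "t < b" for s t
  proof -
    have "{s..t} \<subseteq> {0..1}" "{s..t} \<noteq> {}" using that ab by auto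
    then obtain x where x: "x \<in> {s..t}" "\<And>w. w \<in> {s..t} \<Longrightarrow> C x \<le> C w"
      using continuous_attains_inf[OF compact_Icc _ continuous_on_subset[OF Cc]] by metis
    then have "0 < C x" using Cpos that by simp
    moreover have "tail q1 w + C x \<le> cap q2 w" if "w \<in> {s..t}" for w using x(2)[OF that] by (simp add: C_def)
    ultimately show ?thesis by blast
  qed
  obtain y where y: "0 < y" "y \<le> 1" "1 - b < q2 y" "q2 y < 1 - a"
    using value_strictly_between_if_slack[OF q1 q2 ab(1,4,2,3) ends] z(3) by blast
  show ?thesis
  proof (cases "\<exists>s x t. a < s \<and> s < x \<and> x < t \<and> t < b \<and> q1 s < q1 x \<and> q1 x < q1 t")
    case True
    then obtain s x t where sxt: "a < s" "s < x" "x < t" "t < b" "q1 s < q1 x" "q1 x < q1 t" by blast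
    \<comment> \<open>The interval is widened, still strictly inside the slack interval, until
      \<open>q2 y\<close> lies strictly between \<open>1 - t'\<close> and
      \<open>1 - s'\<close>.\<close>
    define s' where "s' = min s ((a + 1 - q2 y) / 2)"
    define t' where "t' = max t ((b + 1 - q2 y) / 2)"
    have s': "a < s'" "s' \<le> s" "q2 y < 1 - s'" using sxt y by (auto simp: s'_def min_def field_simps)
    have t': "t' < b" "t \<le> t'" "1 - t' < q2 y" using sxt y by (auto simp: t'_def max_def field_simps)
    obtain e where e: "e > 0" "\<forall>x\<in>{s'..t'}. tail q1 x + e \<le> cap q2 x"
      using slack[of s' t'] s' t' sxt by auto
    \<comment> \<open>With \<open>m = s'\<close> the plateau is empty, so the constant
      \<open>c = 0\<close> is arbitrary.\<close>
    show ?thesis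
    proof (rule not_extreme_if_tent_perturb[OF q1 q2 le eq, where s = s' and m = s' and t = t'
          and a = "q1 s" and b = "q1 t" and ?x0.0 = x and ?y0.0 = y and e = e and c = 0])
      show "0 \<le> q1 s" "q1 t \<le> 1" using nlc_range[OF q1] sxt ab by auto
      show "q1 w \<le> q1 s" if "0 \<le> w" "w \<le> s'" for w
        using nlc_mono[OF q1 that(1), of s] that s' sxt ab by auto
      show "q1 t \<le> q1 w" if "t' < w" "w \<le> 1" for w
        using nlc_mono[OF q1 _ _ that(2), of t] that t' sxt ab by auto
    qed (use s' t' sxt ab y e in auto)
  next
    case False
    \<comment> \<open>Here \<open>m\<close> is the right end of the plateau of the lowest value, and
      \<open>k\<close> marks the gap above that value.\<close>
    have "\<exists>m k. a < m \<and> m \<le> b \<and> (\<forall>x. a < x \<longrightarrow> x \<le> m \<longrightarrow> q1 x = q1 m) \<and>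
      q1 m < k \<and> k \<le> 1 \<and> (\<forall>x. m < x \<longrightarrow> x \<le> 1 \<longrightarrow> k \<le> q1 x)"
    proof (cases "\<exists>s t. a < s \<and> s < t \<and> t < b \<and> q1 s < q1 t")
      case True
      then obtain s t where st: "a < s" "s < t" "t < b" "q1 s < q1 t" by blast
      \<comment> \<open>With two values, the plateau ends at the last point carrying the lower one;
        left continuity ensures that the supremum still carries it.\<close>
      define X where "X = {x \<in> {s..t}. q1 x \<le> q1 s}"
      define m where "m = Sup X"
      have bdd: "bdd_above X" by (auto simp: X_def intro!: bdd_aboveI[of _ t])
      have sX: "s \<in> X" using st by (simp add: X_def)
      have sm: "s \<le> m" unfolding m_def by (rule cSup_upper[OF sX bdd])
      have mt: "m \<le> t" unfolding m_def by (rule cSup_least) (use sX in \<open>auto simp: X_def\<close>)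
      have "q1 m \<le> q1 s"
      proof (rule ccontr)
        assume "\<not> q1 m \<le> q1 s"
        then obtain w where w: "0 < w" "w < m" "\<And>v. \<lbrakk>w \<le> v; v \<le> m\<rbrakk> \<Longrightarrow> q1 s < q1 v"
          using nlc_left[OF q1, of m "q1 s"] sm mt st ab by auto
        obtain v where v: "v \<in> X" "w < v" using less_cSupD[of X w] sX w(2) m_def by blast
        then have "v \<le> m" unfolding m_def using bdd by (intro cSup_upper)
        then show False using w(3)[OF less_imp_le[OF v(2)]] v(1) by (simp add: X_def)
      qed
      then have qm: "q1 m = q1 s" using nlc_mono[OF q1, of s m] sm mt st ab by auto
      then have "m < t" using mt st by (cases "m = t") auto
      have left: "q1 x = q1 s" if x: "a < x" "x \<le> m" for x
      proof (cases "x < s")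
        case True
        then have "\<not> q1 x < q1 s" using False x st ab by blast
        then show ?thesis using nlc_mono[OF q1, of x s] True x st ab by auto
      next
        case x': False
        then show ?thesis using nlc_mono[OF q1, of s x] nlc_mono[OF q1, of x m] qm x st mt ab by auto
      qed
      have right: "q1 t \<le> q1 x" if x: "m < x" "x \<le> 1" for x
      proof (cases "t \<le> x")
        case True
        then show ?thesis using nlc_mono[OF q1, of t x] x st ab by auto
      next
        case tx: False
        have "x \<notin> X" using cSup_upper[OF _ bdd, of x] x unfolding m_def by auto
        then have "q1 s < q1 x" using tx x sm by (simp add: X_def)
        then show ?thesis using False tx x sm st by (meson le_less_trans not_le)
      qed
      have "a < m" "m \<le> b" "q1 s < q1 t" "q1 t \<le> 1"
        using sm \<open>m < t\<close> st nlc_range[OF q1, of t] ab by auto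
      then show ?thesis unfolding qm[symmetric] using left right qm by metis
    next
      \<comment> \<open>With one value the plateau fills the interval up to and including
        \<open>b\<close>, and the gap above it comes from the slope bound to the right of
        \<open>b\<close>.\<close>
      case const: False
      have eqz: "q1 x = q1 z" if "a < x" "x < b" for x
        using const nlc_mono[OF q1, of x z] nlc_mono[OF q1, of z x] that ab
        by (metis less_le_trans less_imp_le linorder_less_linear order_less_le order_trans)
      have "q1 b \<le> q1 z"
      proof (rule ccontr)
        assume "\<not> q1 b \<le> q1 z"
        then obtain w where w: "w < b" "\<And>v. \<lbrakk>w \<le> v; v \<le> b\<rbrakk> \<Longrightarrow> q1 z < q1 v"
          using nlc_left[OF q1, of b "q1 z"] ab by auto
        then show False using w(2)[of "max w z"] eqz[of "max w z"] w(1) ab by simp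
      qed
      then have qb: "q1 b = q1 z" using nlc_mono[OF q1, of z b] ab by auto
      obtain k where k: "k \<le> 1" "q1 z < k" "\<And>x. \<lbrakk>b < x; x \<le> 1\<rbrakk> \<Longrightarrow> k \<le> q1 x"
        using right_values_bounded_if_slack[OF q1 q2 le z(1) ab(3,4) ends(2) z(3)] by blast
      have "q1 x = q1 b" if "a < x" "x \<le> b" for x
        using eqz[of x] qb that by (cases "x = b") auto
      moreover have "a < b" using ab by simp
      ultimately show ?thesis using k qb by (metis order_refl)
    qed
    then obtain m k where m: "a < m" "m \<le> b" and qm: "\<And>x. \<lbrakk>a < x; x \<le> m\<rbrakk> \<Longrightarrow> q1 x = q1 m"
      and k: "q1 m < k" "k \<le> 1" "\<And>x. \<lbrakk>m < x; x \<le> 1\<rbrakk> \<Longrightarrow> k \<le> q1 x" by blast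
    define x where "x = (a + m) / 2"
    have x: "a < x" "x < m" using m by (auto simp: x_def)
    have "tail q1 x < cap q2 x" using Cpos[of x] x m by (simp add: C_def)
    then obtain l where l: "0 \<le> l" "l < q1 x" and la: "\<And>w. \<lbrakk>0 < w; w \<le> a\<rbrakk> \<Longrightarrow> q1 w \<le> l"
      using left_values_bounded_if_slack[OF q1 q2 le ab(1) x(1) _ ends(1)] x m ab by auto
    have low: "q1 w \<le> l" if "0 \<le> w" "w \<le> a" for w
      using la[of w] that q10 l by (cases "w = 0") auto
    \<comment> \<open>If the plateau ends at \<open>b\<close>, nothing lies between \<open>m\<close>
      and \<open>t = b\<close>, and \<open>e = 1\<close> is a dummy. Otherwise \<open>t\<close>
      stays below \<open>b\<close>, so the slack on \<open>{m..t}\<close> has a positive minimum,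
      yet is large enough for \<open>q2 y\<close> to exceed \<open>1 - t\<close>.\<close>
    obtain t e where t: "m \<le> t" "t \<le> b" "1 - t < q2 y" "0 < e"
      and te: "\<And>w. \<lbrakk>m \<le> w; w < t\<rbrakk> \<Longrightarrow> tail q1 w + e \<le> cap q2 w"
    proof (cases "m = b")
      case True
      then show thesis using that[of b 1] y by auto
    next
      case False
      define t where "t = max m ((b + 1 - q2 y) / 2)"
      have t: "t < b" "m \<le> t" "1 - t < q2 y" using False m y by (auto simp: t_def max_def field_simps)
      obtain e where "e > 0" "\<forall>w\<in>{m..t}. tail q1 w + e \<le> cap q2 w"
        using slack[of m t] t m by auto
      then show thesis using that[of t e] t by auto
    qed
    have "q1 x = q1 m" using x by (intro qm) auto
    show ?thesis
    proof (rule not_extreme_if_tent_perturb[OF q1 q2 le eq, where s = a and m = m and t = t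
          and a = l and b = k and ?x0.0 = x and ?y0.0 = y and e = e and c = "q1 m"])
      show "q1 w \<le> l" if "0 \<le> w" "w \<le> a" for w using low that .
      show "k \<le> q1 w" if "t < w" "w \<le> 1" for w using k(3)[of w] that t(1) by linarith
      show "q1 w = q1 m" if "a < w" "w \<le> m" for w using qm that .
      show "tail q1 w + e \<le> cap q2 w" if "m \<le> w" "w < t" for w using te that .
      show "l < q1 x" "q1 x < k" using l(2) k(1) \<open>q1 x = q1 m\<close> by simp_all
    qed (use l(1) k(2) x m t ab y in linarith)+
  qed
qed

theorem proposition5:
  fixes q :: "ae_fun \<times> ae_fun"
  shows "q extreme_point_of majorization_pairs \<longleftrightarrow>
    (\<exists>q\<^sub>1\<in>nondecr_left_cont. \<exists>q\<^sub>2\<in>nondecr_left_cont.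
       q = (ae_class q\<^sub>1, ae_class q\<^sub>2) \<and> ae_class q\<^sub>1 = ae_class (conjugate q\<^sub>2))"
proof
  assume q: "q extreme_point_of majorization_pairs"
  then have "q \<in> majorization_pairs" by (simp add: extreme_point_of_def)
  then obtain p q2 where pq: "q = (ae_class p, ae_class q2)"
    and p: "p \<in> nondecr_left_cont" and q2: "q2 \<in> nondecr_left_cont"
    and le: "\<And>x. \<lbrakk>0 \<le> x; x \<le> 1\<rbrakk> \<Longrightarrow> tail p x \<le> cap q2 x" and eq: "tail p 0 = cap q2 0"
    using majorization_pairsE by blast
  \<comment> \<open>Resetting the value at 0 leaves the class unchanged and supplies the
    normalization required by \<open>not_extreme_if_slack\<close>.\<close>
  define q1 where "q1 = p(0 := 0)"
  have q1: "q1 \<in> nondecr_left_cont"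
  proof (rule nlcI)
    fix x l :: real assume x: "0 < x" "x \<le> 1" "l < q1 x"
    then obtain y where "0 < y" "y < x" "l < p y"
      using nlc_left[OF p x(1,2), of l] by (metis fun_upd_other less_imp_le order_refl q1_def less_irrefl)
    then show "\<exists>y. 0 \<le> y \<and> y < x \<and> l < q1 y" by (intro exI[of _ y]) (auto simp: q1_def)
  qed (use nlc_range[OF p] nlc_mono[OF p] in \<open>auto simp: q1_def\<close>)
  have cl: "ae_class q1 = ae_class p" by (rule ae_class_eqI) (simp add: q1_def)
  have tl: "tail q1 x = tail p x" if "0 \<le> x" for x using tail_eq_if_ae_class_eq[OF cl that] .
  have "tail q1 x = tail (conjugate q2) x" if x: "0 \<le> x" "x \<le> 1" for x
  proof (rule ccontr)
    assume "tail q1 x \<noteq> tail (conjugate q2) x"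
    then have "tail q1 x < cap q2 x" using le[OF x] tl x tail_conjugate[OF q2 x] by simp
    then have "\<not> (ae_class q1, ae_class q2) extreme_point_of majorization_pairs"
      using not_extreme_if_slack[OF q1 q2 _ _ _ x] le eq tl by (simp add: q1_def)
    then show False using q pq cl by simp
  qed
  then have "ae_class q1 = ae_class (conjugate q2)"
    by (intro ae_class_eqI nlc_eq_if_tail_eq[OF q1 conjugate_nlc])
  then show "\<exists>q\<^sub>1\<in>nondecr_left_cont. \<exists>q\<^sub>2\<in>nondecr_left_cont.
       q = (ae_class q\<^sub>1, ae_class q\<^sub>2) \<and> ae_class q\<^sub>1 = ae_class (conjugate q\<^sub>2)"
    using q1 q2 pq cl by metis
next
  assume "\<exists>q\<^sub>1\<in>nondecr_left_cont. \<exists>q\<^sub>2\<in>nondecr_left_cont.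
       q = (ae_class q\<^sub>1, ae_class q\<^sub>2) \<and> ae_class q\<^sub>1 = ae_class (conjugate q\<^sub>2)"
  then show "q extreme_point_of majorization_pairs" using extreme_point_if_conjugate by blast
qed

end
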